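(* Let $G=(V,E)$ be a connected graph, $v\in V$, and let $a^{\mathsf T}x\le b$ be facet-defining for $\textsc{Bond}(G)$. Obtain $\bar G=(\bar V,\bar E)$ from $G$ by replacing $v$ by a triangle on new vertices $v_1,v_2,v_3$ and distributing the edges incident to $v$ arbitrarily among $v_1,v_2,v_3$. Define $\varphi:\bar E\setminus\{v_1v_2,v_1v_3,v_2v_3\}\to E$ by $\varphi(e)=e$ if $v_1,v_2,v_3\notin e$ and $\varphi(e)=vw$ if $e=v_iw$ ($i\in[3]$). Consider the edge weights on $\bar E$ that are $0$ on the three triangle edges $v_jv_k$ and $a_{\varphi(e)}$ on every other edge $e$. For $i=1,2,3$ let $S_i\subseteq\bar V$ with $S_i\cap\{v_1,v_2,v_3\}=\{v_i\}$ be such that $\delta_{\bar G}(S_i)$ is a bond of maximum weight (w.r.t. these weights) among bonds of this form, and let $\omega_i$ be its weight. Define $\bar a\in\mathbb{R}^{\bar E}$ by $\bar a_e=a_{\varphi(e)}$ for non-triangle edges $e$, $\bar a_{v_1v_2}=\tfrac12(b-\omega_1-\omega_2+\omega_3)$, $\bar a_{v_1v_3}=\tfrac12(b-\omega_1+\omega_2-\omega_3)$, $\bar a_{v_2v_3}=\tfrac12(b+\omega_1-\omega_2-\omega_3)$. Then $\bar a^{\mathsf T}x\le b$ defines a facet of $\textsc{Bond}(\bar G)$.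
   Context: For a graph $G=(V,E)$ and $S\subseteq V$, the cut $\delta_G(S)=\{e\in E:|e\cap S|=1\}$ is a bond if $G[S]$ and $G[V\setminus S]$ are connected. The weight of a bond $\delta$ w.r.t. weights $c$ is $\sum_{e\in\delta}c_e$. $x^\delta$ is the incidence vector, $\textsc{Bond}(G)=\mathrm{conv}\{x^\delta:\delta\text{ a bond}\}$. *)

theory Defs
  imports "HOL-Analysis.Analysis"
begin

definition simple_graph :: "'v set \<Rightarrow> 'v set set \<Rightarrow> bool" where
  "simple_graph V E \<longleftrightarrow> finite V \<and> (\<forall>e\<in>E. e \<subseteq> V \<and> card e = 2)"

text \<open>The graph without vertices counts as connected, so in a connected graph the empty cut
  is a bond (take the vertex set \<open>S = {}\<close>) and the origin belongs to the bond polytope.\<close>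

definition connected_graph :: "'v set \<Rightarrow> 'v set set \<Rightarrow> bool" where
  "connected_graph V E \<longleftrightarrow> (\<forall>u\<in>V. \<forall>w\<in>V. (u, w) \<in> {(x, y). {x, y} \<in> E}\<^sup>*)"

definition induced_edges :: "'v set set \<Rightarrow> 'v set \<Rightarrow> 'v set set" where
  "induced_edges E S = {e \<in> E. e \<subseteq> S}"

definition cut :: "'v set set \<Rightarrow> 'v set \<Rightarrow> 'v set set" where
  "cut E S = {e \<in> E. card (e \<inter> S) = 1}"

text \<open>The predicate \<open>cut_is_bond V E S\<close> says that the cut \<open>cut E S\<close> is a bond.\<close>

definition cut_is_bond :: "'v set \<Rightarrow> 'v set set \<Rightarrow> 'v set \<Rightarrow> bool" where
  "cut_is_bond V E S \<longleftrightarrow> S \<subseteq> V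
     \<and> connected_graph S (induced_edges E S)
     \<and> connected_graph (V - S) (induced_edges E (V - S))"

definition bonds :: "'v set \<Rightarrow> 'v set set \<Rightarrow> 'v set set set" where
  "bonds V E = {cut E S |S. cut_is_bond V E S}"

definition cut_weight :: "'v set set \<Rightarrow> ('v set \<Rightarrow> real) \<Rightarrow> 'v set \<Rightarrow> real" where
  "cut_weight E c S = (\<Sum>e\<in>cut E S. c e)"

text \<open>The space of real vectors indexed by \<open>E\<close> is realised as the coordinate subspace of
  \<open>real ^ ('v set)\<close> of vectors vanishing outside \<open>E\<close>; it contains all incidence vectors of
  subsets of \<open>E\<close>. Faces and dimensions of a polytope in it do not depend on the ambient
  space.\<close>

definition incidence_vector :: "'v::finite set set \<Rightarrow> real ^ ('v set)" where
  "incidence_vector D = (\<chi> e. if e \<in> D then 1 else 0)"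

definition bond_polytope :: "'v::finite set \<Rightarrow> 'v set set \<Rightarrow> (real ^ ('v set)) set" where
  "bond_polytope V E = convex hull (incidence_vector ` bonds V E)"

text \<open>Coefficient vectors are functions of which only the values on \<open>E\<close> are used.\<close>

definition facet_defining ::
    "'v::finite set \<Rightarrow> 'v set set \<Rightarrow> ('v set \<Rightarrow> real) \<Rightarrow> real \<Rightarrow> bool" where
  "facet_defining V E a b \<longleftrightarrow>
     (\<forall>x\<in>bond_polytope V E. (\<Sum>e\<in>E. a e * x $ e) \<le> b) \<and>
     {x \<in> bond_polytope V E. (\<Sum>e\<in>E. a e * x $ e) = b} facet_of bond_polytope V E"

text \<open>Replacing \<open>v\<close> by a triangle: for every neighbour \<open>w\<close> of \<open>v\<close>, the vertex \<open>f w\<close> is the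
  triangle vertex that receives the edge \<open>{v, w}\<close>.\<close>

definition triangle :: "'v \<Rightarrow> 'v \<Rightarrow> 'v \<Rightarrow> 'v set set" where
  "triangle v1 v2 v3 = {{v1, v2}, {v1, v3}, {v2, v3}}"

definition split_verts :: "'v set \<Rightarrow> 'v \<Rightarrow> 'v \<Rightarrow> 'v \<Rightarrow> 'v \<Rightarrow> 'v set" where
  "split_verts V v v1 v2 v3 = (V - {v}) \<union> {v1, v2, v3}"

definition split_edges ::
    "'v set set \<Rightarrow> 'v \<Rightarrow> 'v \<Rightarrow> 'v \<Rightarrow> 'v \<Rightarrow> ('v \<Rightarrow> 'v) \<Rightarrow> 'v set set" where
  "split_edges E v v1 v2 v3 f =
     {e \<in> E. v \<notin> e} \<union> {{f w, w} |w. {v, w} \<in> E} \<union> triangle v1 v2 v3"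

definition split_phi :: "'v \<Rightarrow> 'v \<Rightarrow> 'v \<Rightarrow> 'v \<Rightarrow> 'v set \<Rightarrow> 'v set" where
  "split_phi v v1 v2 v3 e =
     (if e \<inter> {v1, v2, v3} = {} then e else insert v (e - {v1, v2, v3}))"

definition split_weight ::
    "'v \<Rightarrow> 'v \<Rightarrow> 'v \<Rightarrow> 'v \<Rightarrow> ('v set \<Rightarrow> real) \<Rightarrow> 'v set \<Rightarrow> real" where
  "split_weight v v1 v2 v3 a e =
     (if e \<in> triangle v1 v2 v3 then 0 else a (split_phi v v1 v2 v3 e))"

definition lifted_coeff ::
    "'v \<Rightarrow> 'v \<Rightarrow> 'v \<Rightarrow> 'v \<Rightarrow> ('v set \<Rightarrow> real) \<Rightarrow> real \<Rightarrow> real \<Rightarrow> real \<Rightarrow> real \<Rightarrow> 'v set \<Rightarrow> real" where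
  "lifted_coeff v v1 v2 v3 a b \<omega>1 \<omega>2 \<omega>3 e =
     (if e = {v1, v2} then (b - \<omega>1 - \<omega>2 + \<omega>3) / 2
      else if e = {v1, v3} then (b - \<omega>1 + \<omega>2 - \<omega>3) / 2
      else if e = {v2, v3} then (b + \<omega>1 - \<omega>2 - \<omega>3) / 2
      else a (split_phi v v1 v2 v3 e))"

end

theory Submission
  imports Defs
begin

text \<open>Up to complementation, a bond of the split graph either avoids the triangle vertices, and is
  then a bond of \<open>G\<close> avoiding \<open>v\<close>, or isolates exactly one triangle vertex \<open>i\<close> from the other two.
  In the first case its lifted weight is its weight in \<open>G\<close>; in the second the two triangle edges
  at \<open>i\<close> contribute \<open>b - \<omega>\<^sub>i\<close>. Hence the lifted inequality is valid, and it is tight at the three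
  bonds \<open>S\<^sub>i\<close> and at all lifts of points of the given facet. The lifts vanish on the triangle, where
  the \<open>S\<^sub>i\<close> have the linearly independent restrictions \<open>(1,1,0)\<close>, \<open>(1,0,1)\<close>, \<open>(0,1,1)\<close>, so the
  dimension of the face grows by at least three, which is the number of new edges. This suffices
  because the bond polytope of a connected graph is full-dimensional: every cut is an edge-disjoint
  union of bonds, and cuts span the edge space.\<close>

section \<open>Linear algebra\<close>

lemma aff_dim_linear_image_left_inverse:
  fixes g :: "'a::euclidean_space \<Rightarrow> 'b::euclidean_space"
  assumes "linear g" "linear h" "\<And>x. x \<in> S \<Longrightarrow> h (g x) = x"
  shows "aff_dim (g ` S) = aff_dim S"
proof (rule antisym)
  have "h ` g ` S = S" using assms(3) by force
  then show "aff_dim S \<le> aff_dim (g ` S)"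
    using aff_dim_linear_image_le[OF assms(2)] by metis
qed (rule aff_dim_linear_image_le[OF assms(1)])

lemma aff_dim_Un_biorthogonal:
  fixes S :: "'a::euclidean_space set" and g y :: "'i \<Rightarrow> 'a"
  assumes "finite I"
    and "\<And>i x. i \<in> I \<Longrightarrow> x \<in> S \<Longrightarrow> g i \<bullet> x = 0"
    and "\<And>i j. i \<in> I \<Longrightarrow> j \<in> I \<Longrightarrow> g i \<bullet> y j = 0 \<longleftrightarrow> i \<noteq> j"
  shows "aff_dim (S \<union> y ` I) = aff_dim S + int (card I)"
  using assms
proof (induction I rule: finite_induct)
  case (insert i I)
  have "S \<union> y ` I \<subseteq> {x. g i \<bullet> x = 0}"
    using insert.prems insert.hyps(2) by force
  then have "affine hull (S \<union> y ` I) \<subseteq> {x. g i \<bullet> x = 0}"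
    by (intro hull_minimal subspace_imp_affine subspace_hyperplane)
  moreover have "g i \<bullet> y i \<noteq> 0" using insert.prems(2) by simp
  ultimately have "aff_dim (insert (y i) (S \<union> y ` I)) = aff_dim (S \<union> y ` I) + 1"
    by (auto simp: aff_dim_insert)
  then show ?case using insert by simp
qed simp

definition coeff_vector :: "'i::finite set \<Rightarrow> ('i \<Rightarrow> real) \<Rightarrow> real ^ 'i" where
  "coeff_vector I a = (\<chi> i. if i \<in> I then a i else 0)"

lemma inner_coeff_vector: "coeff_vector I a \<bullet> x = (\<Sum>i\<in>I. a i * x $ i)"
  unfolding inner_vec_def coeff_vector_def by (intro sum.mono_neutral_cong_right) auto

definition pullback :: "'i::finite set \<Rightarrow> ('i \<Rightarrow> 'j) \<Rightarrow> real ^ 'j::finite \<Rightarrow> real ^ 'i" where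
  "pullback B h x = (\<chi> i. if i \<in> B then x $ h i else 0)"

lemma linear_pullback: "linear (pullback B h)"
  by (rule linearI) (simp_all add: pullback_def vec_eq_iff)

lemma pullback_inv_into:
  assumes "bij_betw h B I" "\<And>i. i \<notin> I \<Longrightarrow> x $ i = 0"
  shows "pullback I (inv_into B h) (pullback B h x) = x"
proof -
  have "inv_into B h i \<in> B" "h (inv_into B h i) = i" if "i \<in> I" for i
    using that assms(1) by (auto simp: bij_betw_def inv_into_into f_inv_into_f)
  then show ?thesis
    using assms(2) by (simp add: pullback_def vec_eq_iff)
qed

lemma inner_coeff_vector_pullback:
  assumes "bij_betw h B I" "B \<subseteq> J" "\<And>i. i \<in> B \<Longrightarrow> a' i = a (h i)"
  shows "coeff_vector J a' \<bullet> pullback B h x = coeff_vector I a \<bullet> x"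
proof -
  have "coeff_vector J a' \<bullet> pullback B h x = (\<Sum>i\<in>B. a (h i) * x $ h i)"
    unfolding inner_coeff_vector pullback_def
    using assms(2,3) by (intro sum.mono_neutral_cong_right) auto
  also have "\<dots> = coeff_vector I a \<bullet> x"
    unfolding inner_coeff_vector by (rule sum.reindex_bij_betw[OF assms(1)])
  finally show ?thesis .
qed

section \<open>Connectivity\<close>

definition reachable :: "'v set set \<Rightarrow> 'v \<Rightarrow> 'v \<Rightarrow> bool" where
  "reachable E u w \<longleftrightarrow> (u, w) \<in> {(x, y). {x, y} \<in> E}\<^sup>*"

lemma connected_graph_iff_reachable:
  "connected_graph V E \<longleftrightarrow> (\<forall>u\<in>V. \<forall>w\<in>V. reachable E u w)"
  by (simp add: connected_graph_def reachable_def)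

lemma reachable_refl [simp]: "reachable E u u"
  by (simp add: reachable_def)

lemma reachable_step: "reachable E u x \<Longrightarrow> {x, y} \<in> E \<Longrightarrow> reachable E u y"
  by (auto simp: reachable_def intro: rtrancl_into_rtrancl)

lemma reachable_trans: "reachable E u x \<Longrightarrow> reachable E x w \<Longrightarrow> reachable E u w"
  by (auto simp: reachable_def intro: rtrancl_trans)

lemma reachable_induct [consumes 1, case_names refl step]:
  assumes "reachable E u w"
    and "P u"
    and "\<And>x y. reachable E u x \<Longrightarrow> {x, y} \<in> E \<Longrightarrow> P x \<Longrightarrow> P y"
  shows "P w"
  using assms(1) unfolding reachable_def
  by (induction rule: rtrancl_induct) (use assms(2,3) in \<open>auto simp: reachable_def\<close>)

lemma connected_graph_contraction_iff:
  assumes surj: "c ` A = B"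
    and edge_image: "\<And>x y. {x, y} \<in> E \<Longrightarrow> c x = c y \<or> {c x, c y} \<in> F"
    and edge_lift: "\<And>x y. {x, y} \<in> F \<Longrightarrow> \<exists>p\<in>A. \<exists>q\<in>A. c p = x \<and> c q = y \<and> {p, q} \<in> E"
    and fibre: "\<And>p q. p \<in> A \<Longrightarrow> q \<in> A \<Longrightarrow> c p = c q \<Longrightarrow> reachable E p q"
  shows "connected_graph A E \<longleftrightarrow> connected_graph B F"
proof
  assume "connected_graph A E"
  moreover have "reachable F (c p) (c q)" if "reachable E p q" for p q
    using that
  proof (induction rule: reachable_induct)
    case (step x y)
    then show ?case using edge_image[of x y] reachable_step[of F "c p" "c x" "c y"] by auto
  qed simp
  ultimately show "connected_graph B F"
    unfolding connected_graph_iff_reachable surj[symmetric] by blast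
next
  assume B: "connected_graph B F"
  have "reachable E p q" if "reachable F (c p) z" "p \<in> A" "q \<in> A" "c q = z" for p q z
    using that
  proof (induction arbitrary: q rule: reachable_induct)
    case refl
    then show ?case using fibre by simp
  next
    case (step x y)
    then obtain r s where rs: "r \<in> A" "s \<in> A" "c r = x" "c s = y" "{r, s} \<in> E"
      using edge_lift by blast
    then have "reachable E p s"
      using step.IH[of r] step.prems(1) reachable_step by fast
    then show ?case
      using fibre[of s q] rs step.prems reachable_trans by metis
  qed
  then show "connected_graph A E"
    using B unfolding connected_graph_iff_reachable surj[symmetric] by blast
qed

abbreviation connected_in :: "'v set set \<Rightarrow> 'v set \<Rightarrow> bool" where
  "connected_in E S \<equiv> connected_graph S (induced_edges E S)"

definition separated :: "'v set set \<Rightarrow> 'v set \<Rightarrow> 'v set \<Rightarrow> bool" where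
  "separated E A B \<longleftrightarrow> A \<inter> B = {} \<and> (\<forall>x\<in>A. \<forall>y\<in>B. {x, y} \<notin> E)"

lemma separated_sym: "separated E A B \<Longrightarrow> separated E B A"
  unfolding separated_def by (metis inf_commute insert_commute)

lemma separated_mono: "separated E A B \<Longrightarrow> A' \<subseteq> A \<Longrightarrow> B' \<subseteq> B \<Longrightarrow> separated E A' B'"
  unfolding separated_def by blast

lemma separated_Un_right:
  "separated E A (B \<union> C) \<longleftrightarrow> separated E A B \<and> separated E A C"
  unfolding separated_def by blast

lemma connected_in_iff_separated:
  "connected_in E S \<longleftrightarrow> (\<forall>A B. separated E A B \<and> A \<union> B = S \<longrightarrow> A = {} \<or> B = {})"
proof
  assume S: "connected_in E S"
  show "\<forall>A B. separated E A B \<and> A \<union> B = S \<longrightarrow> A = {} \<or> B = {}"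
  proof (intro allI impI, elim conjE)
    fix A B assume AB: "separated E A B" "A \<union> B = S"
    have "y \<in> A" if "x \<in> A" "reachable (induced_edges E S) x y" for x y
      using that(2,1)
    proof (induction rule: reachable_induct)
      case (step p q)
      then show ?case using AB by (auto simp: induced_edges_def separated_def)
    qed
    then show "A = {} \<or> B = {}"
      using S AB unfolding connected_graph_iff_reachable separated_def by blast
  qed
next
  assume unsplittable: "\<forall>A B. separated E A B \<and> A \<union> B = S \<longrightarrow> A = {} \<or> B = {}"
  have "reachable (induced_edges E S) u w" if "u \<in> S" "w \<in> S" for u w
  proof -
    define A where "A = {x \<in> S. reachable (induced_edges E S) u x}"
    have "{x, y} \<notin> E" if "x \<in> A" "y \<in> S - A" for x y
      using that reachable_step[of "induced_edges E S" u x y]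
      by (auto simp: A_def induced_edges_def)
    then have "separated E A (S - A)" "A \<union> (S - A) = S"
      by (auto simp: separated_def A_def)
    then have "A = {} \<or> S - A = {}" using unsplittable by blast
    then show ?thesis using that by (auto simp: A_def)
  qed
  then show "connected_in E S"
    by (simp add: connected_graph_iff_reachable)
qed

lemma connected_in_subset_separated:
  assumes "connected_in E S" "separated E A B" "S \<subseteq> A \<union> B"
  shows "S \<subseteq> A \<or> S \<subseteq> B"
proof -
  have "separated E (A \<inter> S) (B \<inter> S)" "(A \<inter> S) \<union> (B \<inter> S) = S"
    using assms(2,3) by (auto simp: separated_def)
  then show ?thesis
    using assms(1,3) unfolding connected_in_iff_separated by blast
qed

lemma connected_in_Un_complement_part:
  assumes V: "connected_in E V"
    and S: "connected_in E S" "S \<noteq> {}" "S \<subseteq> V"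
    and AB: "separated E A B" "A \<union> B = V - S"
  shows "connected_in E (S \<union> B)"
  unfolding connected_in_iff_separated
proof (intro allI impI, elim conjE)
  fix C D assume CD: "separated E C D" "C \<union> D = S \<union> B"
  have part_empty: "C = {}" if "separated E C D" "C \<union> D = S \<union> B" "S \<subseteq> D" for C D
  proof -
    have "C \<subseteq> B" using that by (auto simp: separated_def)
    then have "separated E C A"
      using separated_mono[OF separated_sym[OF AB(1)]] by blast
    then have "separated E C (A \<union> D)" using that(1) by (simp add: separated_Un_right)
    moreover have "C \<union> (A \<union> D) = V" using that AB(2) S(3) by blast
    ultimately show "C = {}"
      using V S(2) \<open>S \<subseteq> D\<close> unfolding connected_in_iff_separated by blast
  qed
  have "S \<subseteq> C \<or> S \<subseteq> D"
    using connected_in_subset_separated[OF S(1) CD(1)] CD(2) by blast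
  then show "C = {} \<or> D = {}"
    using part_empty[of C D] part_empty[of D C] CD separated_sym by blast
qed

lemma separated_Un_induct [consumes 1, case_names connected Un]:
  assumes "finite S"
    and connected: "\<And>A. connected_in E A \<Longrightarrow> P A"
    and Un: "\<And>A B. separated E A B \<Longrightarrow> P A \<Longrightarrow> P B \<Longrightarrow> P (A \<union> B)"
  shows "P S"
  using assms(1)
proof (induction S rule: finite_psubset_induct)
  case (psubset S)
  show ?case
  proof (cases "connected_in E S")
    case False
    then obtain A B where AB: "separated E A B" "A \<union> B = S" "A \<noteq> {}" "B \<noteq> {}"
      unfolding connected_in_iff_separated by blast
    then have "A \<subset> S" "B \<subset> S" by (auto simp: separated_def)
    then have "P (A \<union> B)" by (intro Un[OF AB(1)] psubset.IH)
    then show ?thesis by (simp only: AB(2))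
  qed (rule connected)
qed

section \<open>Cuts and bonds\<close>

lemma simple_graph_edgeE:
  assumes "simple_graph V E" "e \<in> E"
  obtains x y where "e = {x, y}" "x \<noteq> y" "x \<in> V" "y \<in> V"
  using assms unfolding simple_graph_def by (metis card_2_iff insert_subset)

lemma simple_graph_edge_subset: "simple_graph V E \<Longrightarrow> e \<in> E \<Longrightarrow> e \<subseteq> V"
  by (simp add: simple_graph_def)

lemma induced_edges_whole: "simple_graph V E \<Longrightarrow> induced_edges E V = E"
  by (auto simp: induced_edges_def simple_graph_def)

lemma doubleton_in_cut_iff:
  assumes "x \<noteq> y"
  shows "{x, y} \<in> cut E S \<longleftrightarrow> {x, y} \<in> E \<and> (x \<in> S) \<noteq> (y \<in> S)"
  using assms by (cases "x \<in> S"; cases "y \<in> S") (auto simp: cut_def)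

lemma cut_complement:
  assumes "simple_graph V E"
  shows "cut E (V - S) = cut E S"
proof -
  have "e \<in> cut E (V - S) \<longleftrightarrow> e \<in> cut E S" if e: "e \<in> E" for e
  proof -
    obtain x y where "e = {x, y}" "x \<noteq> y" "x \<in> V" "y \<in> V"
      by (rule simple_graph_edgeE[OF assms e])
    then show ?thesis by (auto simp: doubleton_in_cut_iff)
  qed
  then show ?thesis by (auto simp: cut_def)
qed

lemma cut_is_bond_complement:
  assumes "cut_is_bond V E S"
  shows "cut_is_bond V E (V - S)"
  using assms by (simp add: cut_is_bond_def double_diff)

abbreviation cut_vector :: "'v::finite set set \<Rightarrow> 'v set \<Rightarrow> real ^ ('v set)" where
  "cut_vector E S \<equiv> incidence_vector (cut E S)"

lemma cut_vector_empty [simp]: "cut_vector E {} = 0"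
  by (simp add: vec_eq_iff incidence_vector_def cut_def)

lemma cut_vector_Un_separated:
  assumes "simple_graph V E" "separated E A B"
  shows "cut_vector E (A \<union> B) = cut_vector E A + cut_vector E B"
proof -
  have "cut_vector E (A \<union> B) $ e = (cut_vector E A + cut_vector E B) $ e" for e
  proof (cases "e \<in> E")
    case True
    then obtain x y where xy: "e = {x, y}" "x \<noteq> y"
      using assms(1) simple_graph_edgeE by metis
    then have "\<not> (x \<in> A \<and> y \<in> B)" "\<not> (y \<in> A \<and> x \<in> B)" "A \<inter> B = {}"
      using assms(2) True by (auto simp: separated_def insert_commute)
    then show ?thesis
      by (auto simp: xy(1) incidence_vector_def doubleton_in_cut_iff[OF xy(2)])
  qed (simp add: incidence_vector_def cut_def)
  then show ?thesis by (simp add: vec_eq_iff)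
qed

lemma incidence_vector_eq_sum_axis: "incidence_vector D = (\<Sum>e\<in>D. axis e 1)"
  by (simp add: vec_eq_iff incidence_vector_def axis_def)

lemma axis_eq_cut_vectors:
  assumes "simple_graph V E" "{u, w} \<in> E" "u \<noteq> w"
  shows "axis {u, w} 1 = (1/2) *\<^sub>R (cut_vector E {u} + cut_vector E {w} - cut_vector E {u, w})"
proof -
  have "axis {u, w} 1 $ e
      = ((1/2) *\<^sub>R (cut_vector E {u} + cut_vector E {w} - cut_vector E {u, w})) $ e" for e
  proof (cases "e \<in> E")
    case True
    then obtain x y where xy: "e = {x, y}" "x \<noteq> y"
      using assms(1) simple_graph_edgeE by metis
    then show ?thesis
      using True assms(3)
      by (auto simp: xy(1) incidence_vector_def axis_def doubleton_in_cut_iff[OF xy(2)]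
          doubleton_eq_iff)
  next
    case False
    then show ?thesis using assms(2) by (auto simp: incidence_vector_def cut_def axis_def)
  qed
  then show ?thesis unfolding vec_eq_iff by blast
qed

lemma cut_vector_in_bond_polytope: "cut_is_bond V E S \<Longrightarrow> cut_vector E S \<in> bond_polytope V E"
  by (auto simp: bond_polytope_def bonds_def intro: hull_inc)

lemma bond_polytope_nth_eq_0:
  assumes "x \<in> bond_polytope V E" "e \<notin> E"
  shows "x $ e = 0"
proof -
  have "convex {x :: real ^ 'a set. x $ e = 0}"
    by (intro subspace_imp_convex) (auto simp: subspace_def)
  then have "bond_polytope V E \<subseteq> {x. x $ e = 0}"
    unfolding bond_polytope_def using assms(2)
    by (intro hull_minimal) (auto simp: bonds_def incidence_vector_def cut_def)
  then show ?thesis using assms(1) by blast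
qed

section \<open>The bond polytope is full-dimensional\<close>

locale simple_connected_graph =
  fixes V :: "'v::finite set" and E :: "'v set set"
  assumes simple: "simple_graph V E" and connected: "connected_graph V E"
begin

lemma connected_in_whole: "connected_in E V"
  using connected by (simp add: induced_edges_whole[OF simple])

lemma cut_is_bond_empty: "cut_is_bond V E {}"
  using connected_in_whole by (simp add: cut_is_bond_def connected_graph_def)

text \<open>If \<open>S\<close> is connected, every component of \<open>V - S\<close> has a connected complement, so its cut is a
  bond.\<close>

lemma cut_vector_connected_in_span_bonds:
  assumes "S \<subseteq> V" "connected_in E S"
  shows "cut_vector E S \<in> span (incidence_vector ` bonds V E)"
proof (cases "S = {}")
  case False
  have "cut_vector E A \<in> span (incidence_vector ` bonds V E)"
    if "A \<subseteq> V - S" "separated E A (V - S - A)" for A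
    using finite[of A] that
  proof (induction A rule: separated_Un_induct[where E = E])
    case (connected A)
    then have "connected_in E (S \<union> (V - S - A))"
      using connected_in_Un_complement_part[OF connected_in_whole assms(2) False assms(1)] by blast
    moreover have "S \<union> (V - S - A) = V - A" using connected.prems(1) assms(1) by blast
    ultimately have "cut_is_bond V E A"
      using connected by (auto simp: cut_is_bond_def)
    then show ?case by (auto simp: bonds_def intro: span_base)
  next
    case (Un A B)
    have "V - S - A = B \<union> (V - S - (A \<union> B))" "V - S - B = A \<union> (V - S - (A \<union> B))"
      using Un.hyps Un.prems(1) by (auto simp: separated_def)
    moreover have "separated E A (V - S - (A \<union> B))" "separated E B (V - S - (A \<union> B))"
      using separated_mono[OF Un.prems(2)] by blast+
    ultimately have "separated E A (V - S - A)" "separated E B (V - S - B)"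
      using Un.hyps separated_sym[OF Un.hyps(1)] by (simp_all add: separated_Un_right)
    then show ?case
      using Un by (simp add: cut_vector_Un_separated[OF simple] span_add)
  qed
  from this[of "V - S"] show ?thesis
    by (simp add: separated_def cut_complement[OF simple])
qed (simp add: span_zero)

lemma cut_vector_in_span_bonds:
  assumes "S \<subseteq> V"
  shows "cut_vector E S \<in> span (incidence_vector ` bonds V E)"
  using finite[of S] assms
proof (induction S rule: separated_Un_induct[where E = E])
  case (connected A)
  then show ?case by (intro cut_vector_connected_in_span_bonds)
next
  case (Un A B)
  then show ?case by (simp add: cut_vector_Un_separated[OF simple] span_add)
qed

lemma span_bonds: "span (incidence_vector ` bonds V E) = span ((\<lambda>e. axis e 1) ` E)"
  unfolding span_eq
proof
  have "incidence_vector D \<in> span ((\<lambda>e. axis e 1) ` E)" if "D \<subseteq> E" for D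
    using that unfolding incidence_vector_eq_sum_axis by (intro span_sum span_base) auto
  then show "incidence_vector ` bonds V E \<subseteq> span ((\<lambda>e. axis e 1) ` E)"
    by (auto simp: bonds_def cut_def)
  show "(\<lambda>e. axis e 1) ` E \<subseteq> span (incidence_vector ` bonds V E)"
  proof clarify
    fix e assume "e \<in> E"
    then obtain u w where uw: "e = {u, w}" "u \<noteq> w" "u \<in> V" "w \<in> V"
      by (rule simple_graph_edgeE[OF simple])
    then show "axis e 1 \<in> span (incidence_vector ` bonds V E)"
      using \<open>e \<in> E\<close> unfolding uw(1)
      by (subst axis_eq_cut_vectors[OF simple])
        (auto intro!: span_scale span_add span_diff cut_vector_in_span_bonds)
  qed
qed

theorem aff_dim_bond_polytope: "aff_dim (bond_polytope V E) = int (card E)"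
proof -
  let ?A = "(\<lambda>e. axis e (1::real)) ` E"
  have "0 \<in> incidence_vector ` bonds V E"
    using cut_is_bond_empty cut_vector_empty[of E] unfolding bonds_def by force
  then have "aff_dim (bond_polytope V E) = int (dim (incidence_vector ` bonds V E))"
    by (simp add: bond_polytope_def aff_dim_convex_hull aff_dim_zero hull_inc)
  also have "dim (incidence_vector ` bonds V E) = dim ?A"
    using span_bonds by (metis dim_span)
  also have "\<dots> = card ?A"
    by (intro dim_eq_card_independent independent_mono[OF independent_Basis])
      (auto simp: axis_in_Basis_iff)
  also have "\<dots> = card E"
    by (intro card_image inj_onI) (simp add: axis_eq_axis)
  finally show ?thesis .
qed

end

section \<open>Facet-defining inequalities\<close>

lemma inner_coeff_vector_cut_vector:
  "coeff_vector I a \<bullet> cut_vector E S = (\<Sum>e\<in>I \<inter> cut E S. a e)"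
  unfolding inner_coeff_vector incidence_vector_def
  by (intro sum.mono_neutral_cong_right) auto

lemma cut_weight_eq_inner: "cut_weight E a S = coeff_vector E a \<bullet> cut_vector E S"
  unfolding inner_coeff_vector_cut_vector cut_weight_def
  by (rule arg_cong[where f = "sum a"]) (auto simp: cut_def)

lemma bond_polytope_le_iff:
  "(\<forall>x\<in>bond_polytope V E. coeff_vector E a \<bullet> x \<le> b) \<longleftrightarrow>
   (\<forall>S. cut_is_bond V E S \<longrightarrow> cut_weight E a S \<le> b)"
proof
  assume "\<forall>S. cut_is_bond V E S \<longrightarrow> cut_weight E a S \<le> b"
  then have "bond_polytope V E \<subseteq> {x. coeff_vector E a \<bullet> x \<le> b}"
    unfolding bond_polytope_def
    by (intro hull_minimal convex_halfspace_le) (auto simp: bonds_def cut_weight_eq_inner)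
  then show "\<forall>x\<in>bond_polytope V E. coeff_vector E a \<bullet> x \<le> b" by blast
qed (auto simp: cut_weight_eq_inner cut_vector_in_bond_polytope)

definition bond_face ::
    "'v::finite set \<Rightarrow> 'v set set \<Rightarrow> ('v set \<Rightarrow> real) \<Rightarrow> real \<Rightarrow> (real ^ ('v set)) set" where
  "bond_face V E a b = {x \<in> bond_polytope V E. coeff_vector E a \<bullet> x = b}"

lemma bond_face_subset: "bond_face V E a b \<subseteq> bond_polytope V E"
  by (auto simp: bond_face_def)

lemma cut_vector_in_bond_face:
  "cut_is_bond V E S \<Longrightarrow> cut_weight E a S = b \<Longrightarrow> cut_vector E S \<in> bond_face V E a b"
  by (simp add: bond_face_def cut_vector_in_bond_polytope cut_weight_eq_inner)

lemma bond_face_face_of: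
  assumes "\<forall>x\<in>bond_polytope V E. coeff_vector E a \<bullet> x \<le> b"
  shows "bond_face V E a b face_of bond_polytope V E"
proof -
  have "bond_face V E a b = bond_polytope V E \<inter> {x. coeff_vector E a \<bullet> x = b}"
    by (auto simp: bond_face_def)
  moreover have "convex (bond_polytope V E)" by (simp add: bond_polytope_def)
  ultimately show ?thesis
    using assms by (simp add: face_of_Int_supporting_hyperplane_le)
qed

lemma (in simple_connected_graph) facet_defining_iff:
  "facet_defining V E a b \<longleftrightarrow>
     (\<forall>S. cut_is_bond V E S \<longrightarrow> cut_weight E a S \<le> b) \<and>
     bond_face V E a b \<noteq> {} \<and> bond_face V E a b \<noteq> bond_polytope V E \<and>
     int (card E) - 1 \<le> aff_dim (bond_face V E a b)"
  (is "_ \<longleftrightarrow> ?valid \<and> ?F \<noteq> {} \<and> ?F \<noteq> ?P \<and> _")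
proof -
  have "facet_defining V E a b \<longleftrightarrow> ?valid \<and> ?F facet_of ?P"
    unfolding facet_defining_def bond_face_def inner_coeff_vector[symmetric] bond_polytope_le_iff ..
  moreover have "?F facet_of ?P \<longleftrightarrow> ?F \<noteq> {} \<and> ?F \<noteq> ?P \<and> int (card E) - 1 \<le> aff_dim ?F"
    if ?valid
  proof -
    have "?F face_of ?P"
      using that bond_face_face_of unfolding bond_polytope_le_iff by blast
    moreover have "aff_dim ?F < aff_dim ?P" if "?F \<noteq> ?P"
      using \<open>?F face_of ?P\<close> that by (intro face_of_aff_dim_lt) (auto simp: bond_polytope_def)
    ultimately show ?thesis
      by (cases "?F = ?P") (simp_all add: facet_of_def aff_dim_bond_polytope, linarith)
  qed
  ultimately show ?thesis by blast
qed

section \<open>Replacing a vertex by a triangle\<close>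

locale vertex_split = simple_connected_graph V E
  for V :: "'v::finite set" and E :: "'v set set" +
  fixes v v1 v2 v3 :: 'v and f :: "'v \<Rightarrow> 'v"
  assumes v_in: "v \<in> V"
    and new: "v1 \<notin> V" "v2 \<notin> V" "v3 \<notin> V"
    and distinct: "v1 \<noteq> v2" "v1 \<noteq> v3" "v2 \<noteq> v3"
    and f_in: "\<And>w. {v, w} \<in> E \<Longrightarrow> f w \<in> {v1, v2, v3}"
begin

abbreviation "T \<equiv> {v1, v2, v3}"
abbreviation "Tri \<equiv> triangle v1 v2 v3"
abbreviation "V' \<equiv> split_verts V v v1 v2 v3"
abbreviation "E' \<equiv> split_edges E v v1 v2 v3 f"
abbreviation "\<phi> \<equiv> split_phi v v1 v2 v3"

definition contract :: "'v \<Rightarrow> 'v" where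
  "contract x = (if x \<in> T then v else x)"

lemma phi_eq_image_contract: "\<phi> e = contract ` e"
  by (auto simp: split_phi_def contract_def)

lemma T_disjoint: "T \<inter> V = {}"
  using new by auto

lemma Tri_iff: "e \<in> Tri \<longleftrightarrow> (\<exists>i\<in>T. \<exists>j\<in>T. i \<noteq> j \<and> e = {i, j})"
  using distinct by (simp add: triangle_def) (metis insert_commute)

lemma triangle_edges_at:
  "{e \<in> Tri. v1 \<in> e} = {{v1, v2}, {v1, v3}}"
  "{e \<in> Tri. v2 \<in> e} = {{v1, v2}, {v2, v3}}"
  "{e \<in> Tri. v3 \<in> e} = {{v1, v3}, {v2, v3}}"
  using distinct by (auto simp: triangle_def)

lemma Tri_subset: "Tri \<subseteq> E'"
  by (auto simp: split_edges_def)

lemma neighbour: "{v, w} \<in> E \<Longrightarrow> w \<in> V - {v}"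
  using simple simple_graph_edge_subset[OF simple, of "{v, w}"] by (auto simp: simple_graph_def)

lemma split_edge_cases [consumes 1, case_names triangle old moved]:
  assumes "e \<in> E'"
  obtains "e \<in> Tri" | "e \<in> E" "v \<notin> e" | w where "e = {f w, w}" "{v, w} \<in> E"
  using assms unfolding split_edges_def by blast

lemma old_edge:
  assumes "e \<in> E" "v \<notin> e"
  shows "e \<in> E' - Tri" "\<phi> e = e"
  using assms simple_graph_edge_subset[OF simple, of e] T_disjoint
  by (auto simp: split_edges_def split_phi_def Tri_iff)

lemma moved_edge:
  assumes "{v, w} \<in> E"
  shows "{f w, w} \<in> E' - Tri" "\<phi> {f w, w} = {v, w}"
proof -
  have "w \<notin> T" "f w \<in> T" using assms neighbour[of w] T_disjoint f_in[of w] by auto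
  then show "\<phi> {f w, w} = {v, w}"
    unfolding phi_eq_image_contract contract_def
    by (simp only: image_insert image_empty if_True if_False)
  have "{f w, w} \<notin> Tri" using \<open>w \<notin> T\<close> unfolding Tri_iff by blast
  then show "{f w, w} \<in> E' - Tri" using assms by (auto simp: split_edges_def)
qed

lemma simple_graph_split: "simple_graph V' E'"
  unfolding simple_graph_def
proof (intro conjI ballI)
  fix e assume "e \<in> E'"
  then have "e \<subseteq> V' \<and> card e = 2"
  proof (cases rule: split_edge_cases)
    case triangle
    then show ?thesis by (auto simp: Tri_iff split_verts_def)
  next
    case old
    then show ?thesis using simple by (auto simp: simple_graph_def split_verts_def)
  next
    case (moved w)
    then have "w \<noteq> f w" "w \<in> V - {v}" "f w \<in> T"
      using neighbour[of w] f_in[of w] T_disjoint by auto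
    then show ?thesis using moved(1) by (auto simp: split_verts_def)
  qed
  then show "e \<subseteq> V'" "card e = 2" by auto
qed simp

lemma phi_cases [consumes 1, case_names old moved]:
  assumes "e \<in> E' - Tri"
  obtains "e \<in> E" "v \<notin> e" "\<phi> e = e" | w where "e = {f w, w}" "{v, w} \<in> E" "\<phi> e = {v, w}"
proof -
  have "e \<in> E'" using assms by simp
  then show thesis
  proof (cases rule: split_edge_cases)
    case triangle
    then show thesis using assms by simp
  next
    case old
    then show thesis using that(1) old_edge(2) by simp
  next
    case (moved w)
    then show thesis using that(2) moved_edge(2) by simp
  qed
qed

lemma bij_betw_phi: "bij_betw \<phi> (E' - Tri) E"
proof (rule bij_betw_imageI)
  show "inj_on \<phi> (E' - Tri)"
  proof (rule inj_onI)
    fix d e assume "d \<in> E' - Tri" "e \<in> E' - Tri" "\<phi> d = \<phi> e"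
    then show "d = e"
      by (elim phi_cases) (auto simp: doubleton_eq_iff)
  qed
  show "\<phi> ` (E' - Tri) = E"
  proof (intro equalityI image_subsetI subsetI)
    show "\<phi> e \<in> E" if "e \<in> E' - Tri" for e
      using that by (cases rule: phi_cases) simp_all
    show "e \<in> \<phi> ` (E' - Tri)" if e: "e \<in> E" for e
    proof (cases "v \<in> e")
      case True
      obtain x y where "e = {x, y}" by (rule simple_graph_edgeE[OF simple e])
      with True obtain w where "e = {v, w}" by blast
      then show ?thesis using e moved_edge[of w] by (metis image_eqI)
    next
      case False
      show ?thesis
        using old_edge[OF e False] by (intro image_eqI[of e \<phi> e]) simp_all
    qed
  qed
qed

lemma card_split_edges: "card E' = card E + 3"
proof -
  have "card Tri = 3"
    using distinct by (simp add: triangle_def doubleton_eq_iff)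
  moreover have "card (E' - Tri) = card E"
    using bij_betw_phi by (rule bij_betw_same_card)
  moreover have "card E' = card (E' - Tri) + card Tri"
    using card_Diff_subset[of Tri E'] card_mono[of E' Tri] Tri_subset by simp
  ultimately show ?thesis by simp
qed

subsection \<open>Bonds of the split graph\<close>

lemma contract_in_iff: "S \<subseteq> V - {v} \<Longrightarrow> contract x \<in> S \<longleftrightarrow> x \<in> S"
  using T_disjoint by (auto simp: contract_def)

lemma image_contract_complement:
  assumes "S \<subseteq> V - {v}"
  shows "contract ` (V' - S) = V - S"
proof -
  have "contract ` V' = V"
    using v_in T_disjoint by (force simp: contract_def split_verts_def image_iff)
  moreover have "contract ` (V' - S) = contract ` V' - S"
    by (auto simp: contract_in_iff[OF assms])
  ultimately show ?thesis by simp
qed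

lemma contract_edge:
  assumes "{x, y} \<in> E'"
  shows "contract x = contract y \<or> {contract x, contract y} \<in> E"
proof (cases "{x, y} \<in> Tri")
  case True
  then have "x \<in> T" "y \<in> T" by (auto simp: Tri_iff doubleton_eq_iff)
  then show ?thesis by (simp add: contract_def)
next
  case False
  then show ?thesis
    using assms bij_betw_apply[OF bij_betw_phi, of "{x, y}"] by (simp add: phi_eq_image_contract)
qed

lemma edge_eq_contract:
  assumes "{x, y} \<in> E"
  obtains p q where "{p, q} \<in> E'" "contract p = x" "contract q = y"
proof -
  have "{x, y} \<in> \<phi> ` (E' - Tri)"
    using assms bij_betw_imp_surj_on[OF bij_betw_phi] by simp
  then obtain e where e: "e \<in> E'" "contract ` e = {x, y}"
    by (auto simp: phi_eq_image_contract)
  obtain p q where pq: "e = {p, q}"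
    by (rule simple_graph_edgeE[OF simple_graph_split e(1)])
  then have "contract p = x \<and> contract q = y \<or> contract p = y \<and> contract q = x"
    using e(2) by (simp add: doubleton_eq_iff)
  then show thesis using that[of p q] that[of q p] e(1) pq by (auto simp: insert_commute)
qed

lemma connected_in_split_complement_iff:
  assumes S: "S \<subseteq> V - {v}"
  shows "connected_in E' (V' - S) \<longleftrightarrow> connected_in E (V - S)"
proof (rule connected_graph_contraction_iff[where c = contract])
  show image: "contract ` (V' - S) = V - S"
    by (rule image_contract_complement[OF S])
  show "contract x = contract y \<or> {contract x, contract y} \<in> induced_edges E (V - S)"
    if xy: "{x, y} \<in> induced_edges E' (V' - S)" for x y
  proof -
    have "contract x \<in> V - S" "contract y \<in> V - S"
      using xy unfolding image[symmetric] by (auto simp: induced_edges_def)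
    then show ?thesis
      using xy contract_edge[of x y] by (simp add: induced_edges_def)
  qed
  show "\<exists>p\<in>V' - S. \<exists>q\<in>V' - S. contract p = x \<and> contract q = y \<and> {p, q} \<in> induced_edges E' (V' - S)"
    if xy: "{x, y} \<in> induced_edges E (V - S)" for x y
  proof -
    have "{x, y} \<in> E" using xy by (simp add: induced_edges_def)
    then obtain p q where pq: "{p, q} \<in> E'" "contract p = x" "contract q = y"
      by (rule edge_eq_contract)
    moreover have "{p, q} \<subseteq> V'"
      by (rule simple_graph_edge_subset[OF simple_graph_split pq(1)])
    moreover have "contract p \<notin> S" "contract q \<notin> S"
      using xy unfolding pq(2,3) by (auto simp: induced_edges_def)
    then have "p \<notin> S" "q \<notin> S" by (simp_all add: contract_in_iff[OF S])
    ultimately show ?thesis by (auto simp: induced_edges_def)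
  qed
  show "reachable (induced_edges E' (V' - S)) p q"
    if "p \<in> V' - S" "q \<in> V' - S" "contract p = contract q" for p q
  proof (cases "p = q")
    case False
    then have "p \<in> T" "q \<in> T"
      using that v_in T_disjoint by (auto simp: contract_def split_verts_def split: if_splits)
    then have "{p, q} \<in> Tri" using False unfolding Tri_iff by blast
    then have "{p, q} \<in> induced_edges E' (V' - S)"
      using that(1,2) Tri_subset by (auto simp: induced_edges_def)
    then show ?thesis using reachable_step[OF reachable_refl] by metis
  qed simp
qed

lemma induced_edges_split:
  assumes S: "S \<subseteq> V - {v}"
  shows "induced_edges E' S = induced_edges E S"
proof
  show "induced_edges E S \<subseteq> induced_edges E' S"
    using S by (auto simp: induced_edges_def split_edges_def)
  show "induced_edges E' S \<subseteq> induced_edges E S"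
  proof
    fix e assume "e \<in> induced_edges E' S"
    then have "e \<in> E'" "e \<subseteq> S" by (auto simp: induced_edges_def)
    moreover have "e \<inter> T = {}" using \<open>e \<subseteq> S\<close> S T_disjoint by blast
    ultimately show "e \<in> induced_edges E S"
      by (cases rule: split_edge_cases) (use f_in in \<open>auto simp: induced_edges_def Tri_iff\<close>)
  qed
qed

lemma cut_is_bond_split_iff:
  assumes "S \<subseteq> V - {v}"
  shows "cut_is_bond V' E' S \<longleftrightarrow> cut_is_bond V E S"
proof -
  have "S \<subseteq> V" "S \<subseteq> V'" using assms by (auto simp: split_verts_def)
  then show ?thesis
    unfolding cut_is_bond_def connected_in_split_complement_iff[OF assms]
      induced_edges_split[OF assms] by simp
qed

sublocale split: simple_connected_graph V' E'
proof
  show "connected_graph V' E'"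
    using connected_in_split_complement_iff[of "{}"] connected_in_whole
    by (simp add: induced_edges_whole[OF simple_graph_split])
qed (rule simple_graph_split)

lemma bond_split_cases [consumes 1, case_names avoiding isolating]:
  assumes "cut_is_bond V' E' S"
  obtains U where "cut E' S = cut E' U" "cut_is_bond V E U" "U \<subseteq> V - {v}"
  | U i where "cut E' S = cut E' U" "cut_is_bond V' E' U" "i \<in> T" "U \<inter> T = {i}"
proof -
  define U where "U = (if card (S \<inter> T) \<le> 1 then S else V' - S)"
  have U: "cut E' S = cut E' U" "cut_is_bond V' E' U"
    using assms cut_complement[OF simple_graph_split] cut_is_bond_complement
    by (auto simp: U_def)
  have "(V' - S) \<inter> T = T - S \<inter> T" by (auto simp: split_verts_def)
  then have "card ((V' - S) \<inter> T) = 3 - card (S \<inter> T)"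
    using distinct by (simp add: card_Diff_subset)
  then have "card (U \<inter> T) \<le> 1" unfolding U_def by (cases "card (S \<inter> T) \<le> 1") simp_all
  then have "card (U \<inter> T) = 0 \<or> card (U \<inter> T) = 1" by linarith
  then consider (avoids) "U \<inter> T = {}" | (isolates) i where "U \<inter> T = {i}"
    unfolding card_1_singleton_iff One_nat_def by auto
  then show thesis
  proof cases
    case avoids
    then have "U \<subseteq> V - {v}"
      using U(2) v_in new unfolding cut_is_bond_def split_verts_def by blast
    then show thesis using that(1) U cut_is_bond_split_iff by blast
  next
    case (isolates i)
    then show thesis using that(2)[of U i] U by blast
  qed
qed

lemma bond_avoiding_splitE:
  assumes "D \<in> bonds V E"
  obtains S where "D = cut E S" "cut_is_bond V E S" "S \<subseteq> V - {v}"
proof -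
  obtain S where S: "D = cut E S" "cut_is_bond V E S"
    using assms unfolding bonds_def by blast
  show thesis
  proof (cases "v \<in> S")
    case True
    then show thesis
      using that[of "V - S"] S cut_complement[OF simple] cut_is_bond_complement by blast
  next
    case False
    then show thesis using that S by (auto simp: cut_is_bond_def)
  qed
qed

subsection \<open>Lifting points of the bond polytope\<close>

definition lift :: "real ^ 'v set \<Rightarrow> real ^ 'v set" where
  "lift = pullback (E' - Tri) \<phi>"

lemma lift_triangle: "e \<in> Tri \<Longrightarrow> lift x $ e = 0"
  by (simp add: lift_def pullback_def)

lemma lift_cut_vector:
  assumes S: "S \<subseteq> V - {v}"
  shows "lift (cut_vector E S) = cut_vector E' S"
proof -
  have ST: "S \<inter> T = {}" "v \<notin> S" using S T_disjoint by auto
  then have "\<phi> e \<inter> S = e \<inter> S" for e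
    by (auto simp: split_phi_def)
  moreover have "\<phi> e \<in> E" if "e \<in> E'" "e \<notin> Tri" for e
    using that bij_betw_apply[OF bij_betw_phi] by blast
  moreover have "e \<notin> Tri" if "card (e \<inter> S) = 1" for e
    using that ST by (auto simp: Tri_iff)
  ultimately have "e \<in> cut E' S \<longleftrightarrow> e \<in> E' - Tri \<and> \<phi> e \<in> cut E S" for e
    by (auto simp: cut_def)
  then show ?thesis
    by (simp add: vec_eq_iff lift_def pullback_def incidence_vector_def)
qed

lemma lift_in_bond_polytope:
  assumes "x \<in> bond_polytope V E"
  shows "lift x \<in> bond_polytope V' E'"
proof -
  have "linear lift" unfolding lift_def by (rule linear_pullback)
  have "lift ` incidence_vector ` bonds V E \<subseteq> incidence_vector ` bonds V' E'"
  proof clarify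
    fix D assume "D \<in> bonds V E"
    then obtain S where "D = cut E S" "cut_is_bond V E S" "S \<subseteq> V - {v}"
      by (rule bond_avoiding_splitE)
    then show "lift (incidence_vector D) \<in> incidence_vector ` bonds V' E'"
      using lift_cut_vector cut_is_bond_split_iff unfolding bonds_def by blast
  qed
  then have "lift ` bond_polytope V E \<subseteq> bond_polytope V' E'"
    unfolding bond_polytope_def convex_hull_linear_image[OF \<open>linear lift\<close>] by (rule hull_mono)
  then show ?thesis using assms by blast
qed

lemma aff_dim_lift_image:
  assumes "F \<subseteq> bond_polytope V E"
  shows "aff_dim (lift ` F) = aff_dim F"
  unfolding lift_def
proof (rule aff_dim_linear_image_left_inverse[OF linear_pullback linear_pullback])
  fix x assume "x \<in> F"
  then show "pullback E (inv_into (E' - Tri) \<phi>) (pullback (E' - Tri) \<phi> x) = x"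
    using assms bond_polytope_nth_eq_0 by (intro pullback_inv_into[OF bij_betw_phi]) blast
qed

lemma cut_Int_triangle:
  assumes "S \<inter> T = {i}"
  shows "Tri \<inter> cut E' S = {e \<in> Tri. i \<in> e}"
proof -
  have "e \<in> cut E' S \<longleftrightarrow> i \<in> e" if "e \<in> Tri" for e
  proof -
    obtain j k where jk: "e = {j, k}" "j \<in> T" "k \<in> T" "j \<noteq> k"
      using \<open>e \<in> Tri\<close> unfolding Tri_iff by blast
    moreover have "x \<in> S \<longleftrightarrow> x = i" if "x \<in> T" for x using that assms by blast
    ultimately show ?thesis
      using Tri_subset \<open>e \<in> Tri\<close> doubleton_in_cut_iff[OF \<open>j \<noteq> k\<close>, of E' S] by auto
  qed
  then show ?thesis by blast
qed

text \<open>The functional that adds the coordinates of the two triangle edges at \<open>i\<close> and subtracts that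
  of the third vanishes on all lifts and at the bonds isolating another triangle vertex.\<close>

lemma aff_dim_lift_Un_isolating_cuts:
  assumes "F \<subseteq> bond_polytope V E" "\<And>i. i \<in> T \<Longrightarrow> S i \<inter> T = {i}"
  shows "aff_dim (lift ` F \<union> (\<lambda>i. cut_vector E' (S i)) ` T) = aff_dim F + 3"
proof -
  define g where "g i = coeff_vector Tri (\<lambda>e. if i \<in> e then 1 else - 1)" for i
  have "g i \<bullet> x = 0" if "x \<in> lift ` F" for i x
    using that lift_triangle by (auto simp: g_def inner_coeff_vector intro!: sum.neutral)
  moreover have "g i \<bullet> cut_vector E' (S j) = 0 \<longleftrightarrow> i \<noteq> j" if "i \<in> T" "j \<in> T" for i j
  proof -
    have "g i \<bullet> cut_vector E' (S j) = (\<Sum>e | e \<in> Tri \<and> j \<in> e. if i \<in> e then 1 else - 1)"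
      using assms(2)[OF \<open>j \<in> T\<close>] unfolding g_def inner_coeff_vector_cut_vector
      by (simp add: cut_Int_triangle)
    also have "\<dots> = (if i = j then 2 else 0)"
      using that distinct by (auto simp: triangle_edges_at doubleton_eq_iff)
    finally show ?thesis by simp
  qed
  ultimately have "aff_dim (lift ` F \<union> (\<lambda>i. cut_vector E' (S i)) ` T)
      = aff_dim (lift ` F) + int (card T)"
    by (intro aff_dim_Un_biorthogonal[where g = g]) auto
  then show ?thesis using distinct by (simp add: aff_dim_lift_image[OF assms(1)])
qed

subsection \<open>The lifted inequality\<close>

abbreviation off_triangle :: "('v set \<Rightarrow> real) \<Rightarrow> 'v set \<Rightarrow> real" where
  "off_triangle \<equiv> split_weight v v1 v2 v3"

abbreviation lifted :: "('v set \<Rightarrow> real) \<Rightarrow> real \<Rightarrow> ('v \<Rightarrow> real) \<Rightarrow> 'v set \<Rightarrow> real" where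
  "lifted a b \<omega> \<equiv> lifted_coeff v v1 v2 v3 a b (\<omega> v1) (\<omega> v2) (\<omega> v3)"

lemma lifted_off_triangle: "e \<notin> Tri \<Longrightarrow> lifted a b \<omega> e = a (\<phi> e)"
  by (auto simp: lifted_coeff_def triangle_def)

lemma sum_lifted_triangle_edges_at:
  assumes "i \<in> T"
  shows "(\<Sum>e | e \<in> Tri \<and> i \<in> e. lifted a b \<omega> e) = b - \<omega> i"
  using assms distinct
  by (auto simp: triangle_edges_at lifted_coeff_def doubleton_eq_iff field_simps)

lemma inner_lifted_lift: "coeff_vector E' (lifted a b \<omega>) \<bullet> lift x = coeff_vector E a \<bullet> x"
  unfolding lift_def
  by (intro inner_coeff_vector_pullback[OF bij_betw_phi]) (simp_all add: lifted_off_triangle)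

lemma cut_weight_lifted_avoiding:
  assumes "S \<subseteq> V - {v}"
  shows "cut_weight E' (lifted a b \<omega>) S = cut_weight E a S"
  by (simp add: cut_weight_eq_inner lift_cut_vector[OF assms, symmetric] inner_lifted_lift)

lemma cut_weight_lifted_isolating:
  assumes "i \<in> T" "S \<inter> T = {i}"
  shows "cut_weight E' (lifted a b \<omega>) S = cut_weight E' (off_triangle a) S + (b - \<omega> i)"
proof -
  have "cut_weight E' (lifted a b \<omega>) S
      = (\<Sum>e\<in>cut E' S - Tri. lifted a b \<omega> e) + (\<Sum>e\<in>Tri \<inter> cut E' S. lifted a b \<omega> e)"
    unfolding cut_weight_def using sum.Int_Diff[of "cut E' S" "lifted a b \<omega>" Tri]
    by (simp add: Int_commute)
  also have "(\<Sum>e\<in>cut E' S - Tri. lifted a b \<omega> e) = cut_weight E' (off_triangle a) S"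
    unfolding cut_weight_def
    by (intro sum.mono_neutral_cong_left) (auto simp: split_weight_def lifted_off_triangle)
  also have "(\<Sum>e\<in>Tri \<inter> cut E' S. lifted a b \<omega> e) = b - \<omega> i"
    unfolding cut_Int_triangle[OF assms(2)] by (rule sum_lifted_triangle_edges_at[OF assms(1)])
  finally show ?thesis .
qed

lemma cut_weight_lifted_le:
  assumes "\<And>S. cut_is_bond V E S \<Longrightarrow> cut_weight E a S \<le> b"
    and "\<And>i S. i \<in> T \<Longrightarrow> S \<inter> T = {i} \<Longrightarrow> cut_is_bond V' E' S \<Longrightarrow>
      cut_weight E' (off_triangle a) S \<le> \<omega> i"
    and "cut_is_bond V' E' S"
  shows "cut_weight E' (lifted a b \<omega>) S \<le> b"
  using assms(3)
proof (cases rule: bond_split_cases)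
  case (avoiding U)
  then have "cut_weight E' (lifted a b \<omega>) S = cut_weight E a U"
    using cut_weight_lifted_avoiding by (simp add: cut_weight_def)
  then show ?thesis using avoiding assms(1) by simp
next
  case (isolating U i)
  then have "cut_weight E' (lifted a b \<omega>) S
      = cut_weight E' (off_triangle a) U + (b - \<omega> i)"
    using cut_weight_lifted_isolating[of i U] by (simp add: cut_weight_def)
  then show ?thesis using isolating assms(2)[of i U] by simp
qed

lemma lift_in_bond_face_iff:
  assumes "x \<in> bond_polytope V E"
  shows "lift x \<in> bond_face V' E' (lifted a b \<omega>) b \<longleftrightarrow> x \<in> bond_face V E a b"
  using assms by (simp add: bond_face_def lift_in_bond_polytope inner_lifted_lift)

lemma bond_face_lifted_neq_bond_polytope:
  assumes "bond_face V E a b \<noteq> bond_polytope V E"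
  shows "bond_face V' E' (lifted a b \<omega>) b \<noteq> bond_polytope V' E'"
proof -
  obtain x where "x \<in> bond_polytope V E" "x \<notin> bond_face V E a b"
    using assms bond_face_subset by blast
  then show ?thesis
    using lift_in_bond_polytope lift_in_bond_face_iff by blast
qed

lemma aff_dim_bond_face_lifted_ge:
  assumes isolating: "\<And>i. i \<in> T \<Longrightarrow> S i \<inter> T = {i}"
    and bond: "\<And>i. i \<in> T \<Longrightarrow> cut_is_bond V' E' (S i)"
    and weight: "\<And>i. i \<in> T \<Longrightarrow> cut_weight E' (off_triangle a) (S i) = \<omega> i"
  shows "aff_dim (bond_face V E a b) + 3 \<le> aff_dim (bond_face V' E' (lifted a b \<omega>) b)"
    (is "aff_dim ?F + 3 \<le> aff_dim ?F'")
proof -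
  have "aff_dim ?F + 3 = aff_dim (lift ` ?F \<union> (\<lambda>i. cut_vector E' (S i)) ` T)"
    by (rule aff_dim_lift_Un_isolating_cuts[OF bond_face_subset isolating, symmetric])
  also have "\<dots> \<le> aff_dim ?F'"
  proof (intro aff_dim_subset Un_least image_subsetI)
    show "lift x \<in> ?F'" if "x \<in> ?F" for x
      using that bond_face_subset lift_in_bond_face_iff by blast
    show "cut_vector E' (S i) \<in> ?F'" if "i \<in> T" for i
      using bond[OF that] cut_weight_lifted_isolating[OF that isolating[OF that], of a b \<omega>]
      by (intro cut_vector_in_bond_face) (simp_all add: weight[OF that])
  qed
  finally show ?thesis .
qed

theorem facet_defining_lifted:
  assumes facet: "facet_defining V E a b"
    and arg_max: "\<And>i. i \<in> T \<Longrightarrow> is_arg_max (cut_weight E' (off_triangle a))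
      (\<lambda>S. S \<inter> T = {i} \<and> cut_is_bond V' E' S) (S i)"
    and weight: "\<And>i. i \<in> T \<Longrightarrow> \<omega> i = cut_weight E' (off_triangle a) (S i)"
  shows "facet_defining V' E' (lifted a b \<omega>) b"
  unfolding split.facet_defining_iff
proof (intro conjI allI impI)
  have S: "S i \<inter> T = {i}" "cut_is_bond V' E' (S i)" if "i \<in> T" for i
    using arg_max[OF that] by (simp_all add: is_arg_max_def)
  let ?F' = "bond_face V' E' (lifted a b \<omega>) b"
  have dim: "aff_dim (bond_face V E a b) + 3 \<le> aff_dim ?F'"
    using aff_dim_bond_face_lifted_ge[OF S weight[symmetric]] .
  show "cut_weight E' (lifted a b \<omega>) U \<le> b" if "cut_is_bond V' E' U" for U
  proof (rule cut_weight_lifted_le[OF _ _ that])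
    show "cut_weight E a S \<le> b" if "cut_is_bond V E S" for S
      using facet that by (simp add: facet_defining_iff)
    show "cut_weight E' (off_triangle a) U \<le> \<omega> i"
      if "i \<in> T" "U \<inter> T = {i}" "cut_is_bond V' E' U" for i U
      using arg_max[OF that(1)] that unfolding is_arg_max_linorder weight[OF that(1)] by blast
  qed
  show "int (card E') - 1 \<le> aff_dim ?F'"
    using dim facet by (simp add: facet_defining_iff card_split_edges)
  show "?F' \<noteq> {}"
    using dim aff_dim_geq[of "bond_face V E a b"] by (auto simp: aff_dim_empty)
  show "?F' \<noteq> bond_polytope V' E'"
    using facet by (intro bond_face_lifted_neq_bond_polytope) (simp add: facet_defining_iff)
qed

end

theorem theorem4p2:
  fixes V V' :: "'v::finite set" and E E' :: "'v set set"
    and v v1 v2 v3 :: 'v and f :: "'v \<Rightarrow> 'v"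
    and a c :: "'v set \<Rightarrow> real" and b \<omega>1 \<omega>2 \<omega>3 :: real
    and S1 S2 S3 :: "'v set"
  assumes "simple_graph V E" and "connected_graph V E" and "v \<in> V"
    and "facet_defining V E a b"
    and "v1 \<notin> V" and "v2 \<notin> V" and "v3 \<notin> V" and "v1 \<noteq> v2" and "v1 \<noteq> v3" and "v2 \<noteq> v3"
    and "\<And>w. {v, w} \<in> E \<Longrightarrow> f w \<in> {v1, v2, v3}"
    and "V' = split_verts V v v1 v2 v3"
    and "E' = split_edges E v v1 v2 v3 f"
    and "c = split_weight v v1 v2 v3 a"
    and "is_arg_max (cut_weight E' c)
           (\<lambda>S. S \<inter> {v1, v2, v3} = {v1} \<and> cut_is_bond V' E' S) S1"
    and "is_arg_max (cut_weight E' c)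
           (\<lambda>S. S \<inter> {v1, v2, v3} = {v2} \<and> cut_is_bond V' E' S) S2"
    and "is_arg_max (cut_weight E' c)
           (\<lambda>S. S \<inter> {v1, v2, v3} = {v3} \<and> cut_is_bond V' E' S) S3"
    and "\<omega>1 = cut_weight E' c S1" and "\<omega>2 = cut_weight E' c S2" and "\<omega>3 = cut_weight E' c S3"
  shows "facet_defining V' E' (lifted_coeff v v1 v2 v3 a b \<omega>1 \<omega>2 \<omega>3) b"
proof -
  interpret vertex_split V E v v1 v2 v3 f
    by unfold_locales (use assms in auto)
  define S where "S = (\<lambda>_. S3)(v1 := S1, v2 := S2)"
  define \<omega> where "\<omega> = (\<lambda>_. \<omega>3)(v1 := \<omega>1, v2 := \<omega>2)"
  have at: "S v1 = S1" "S v2 = S2" "S v3 = S3" "\<omega> v1 = \<omega>1" "\<omega> v2 = \<omega>2" "\<omega> v3 = \<omega>3"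
    using distinct by (simp_all add: S_def \<omega>_def)
  have "facet_defining V' E' (lifted_coeff v v1 v2 v3 a b (\<omega> v1) (\<omega> v2) (\<omega> v3)) b"
    unfolding assms(12,13)
  proof (rule facet_defining_lifted[OF assms(4), where S = S])
    fix i assume "i \<in> {v1, v2, v3}"
    then show "is_arg_max (cut_weight (split_edges E v v1 v2 v3 f) (split_weight v v1 v2 v3 a))
        (\<lambda>S. S \<inter> {v1, v2, v3} = {i}
          \<and> cut_is_bond (split_verts V v v1 v2 v3) (split_edges E v v1 v2 v3 f) S) (S i)"
      and "\<omega> i = cut_weight (split_edges E v v1 v2 v3 f) (split_weight v v1 v2 v3 a) (S i)"
      using assms(15-20) unfolding assms(12-14) by (auto simp only: at insert_iff empty_iff)
  qed
  then show ?thesis by (simp only: at)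
qed

end
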